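(* Let $G$ have property $\mathcal{P}$ and let $\|\cdot\|_G$ be its Orlicz norm. Let $A\in\mathbb{R}^{n\times m}$ have rank $d\leq n$, and let $D\in\mathbb{R}^{n\times n}$ be a diagonal matrix whose diagonal entries are i.i.d. random variables with cumulative distribution function $1-e^{-G(t)}$ ($t\ge0$). Then with probability at least $0.98$, $$\forall x\in\mathbb{R}^m,\quad \Omega\!\left(\frac{1}{\alpha'_G d\log n}\right)\|Ax\|_G\leq\|D^{-1}Ax\|_\infty,$$ where $\alpha'_G\geq1$ is a constant which only depends on $G$.
   Context: A function $G:\mathbb{R}\to\mathbb{R}_+$ has property $\mathcal{P}$ if: (1) $G$ is a nonzero, monotone nondecreasing, convex function on $[0,\infty)$; (2) $G(0)=0$, $G(1)=1$, and $G(x)=G(-x)$ for all $x$; (3) there is $s>0$ such that $G(x)=sx+(1-s)$ for all $x>1$; (4) there is $\delta_G>0$ such that $G$ is twice differentiable on $(0,\delta_G)$, the right derivatives $G'_+(0)$ and $G''_+(0)$ exist (where $G''_+(x)=\lim_{h\to0^+}(G'(x+h)-G'_+(x))/h$), and either $G'_+(0)>0$ or $G''_+(0)>0$; (5) there is $C_G>0$ such that $G(y)/G(x)\leq C_G(y/x)^2$ for all $0<x<y$. The Orlicz norm is $\|x\|_G=\inf\{\alpha>0:\sum_{i=1}^n G(|x_i|/\alpha)\leq1\}$. $\Omega(\cdot)$ hides absolute constants. *)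

theory Defs
  imports
    "HOL-Probability.Probability"
    "Jordan_Normal_Form.DL_Rank"
    "Jordan_Normal_Form.Gauss_Jordan_Elimination"
begin

unbundle no vec_syntax

text \<open>
  In the fourth conjunct \<open>g1\<close> and \<open>g2\<close> are the right derivatives \<open>G'\<^sub>+(0)\<close> and \<open>G''\<^sub>+(0)\<close>.
  The quotient in the last conjunct never divides by zero: the other conjuncts force
  \<open>G x > 0\<close> for \<open>x > 0\<close>.
\<close>

definition property_P :: "(real \<Rightarrow> real) \<Rightarrow> bool" where
  "property_P G \<longleftrightarrow>
     (\<forall>x. G x \<ge> 0) \<and>
     ((\<exists>x\<ge>0. G x \<noteq> 0) \<and> mono_on {0..} G \<and> convex_on {0..} G) \<and>
     (G 0 = 0 \<and> G 1 = 1 \<and> (\<forall>x. G x = G (- x))) \<and>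
     (\<exists>s>0. \<forall>x>1. G x = s * x + (1 - s)) \<and>
     (\<exists>\<delta>>0. (\<forall>x\<in>{0<..<\<delta>}. G differentiable (at x) \<and> deriv G differentiable (at x)) \<and>
        (\<exists>g1 g2. (G has_real_derivative g1) (at_right 0) \<and>
           ((\<lambda>h. (deriv G (0 + h) - g1) / h) \<longlongrightarrow> g2) (at_right 0) \<and>
           (g1 > 0 \<or> g2 > 0))) \<and>
     (\<exists>C>0. \<forall>x y. 0 < x \<and> x < y \<longrightarrow> G y / G x \<le> C * (y / x)\<^sup>2)"

definition orlicz_norm :: "(real \<Rightarrow> real) \<Rightarrow> real vec \<Rightarrow> real" where
  "orlicz_norm G x = Inf {\<alpha>. \<alpha> > 0 \<and> (\<Sum>i<dim_vec x. G (\<bar>x $ i\<bar> / \<alpha>)) \<le> 1}"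

text \<open>The inserted \<open>0\<close> only matters for the vector of dimension zero.\<close>

definition linf_norm :: "real vec \<Rightarrow> real" where
  "linf_norm x = Max (insert 0 ((\<lambda>i. \<bar>x $ i\<bar>) ` {..<dim_vec x}))"

text \<open>
  A random diagonal \<open>n \<times> n\<close> matrix with i.i.d.\ diagonal entries of distribution function
  \<open>1 - exp (- G t)\<close> for \<open>t \<ge> 0\<close>.  When \<open>G 0 = 0\<close>, the value at \<open>t = 0\<close> makes the distribution
  function vanish on the negative reals.
\<close>

definition random_diagonal_mat ::
    "(real \<Rightarrow> real) \<Rightarrow> nat \<Rightarrow> 'a measure \<Rightarrow> ('a \<Rightarrow> real mat) \<Rightarrow> bool" where
  "random_diagonal_mat G n M D \<longleftrightarrow>
     prob_space M \<and>
     (\<forall>\<omega>\<in>space M. D \<omega> \<in> carrier_mat n n \<and> diagonal_mat (D \<omega>)) \<and>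
     prob_space.indep_vars M (\<lambda>_. borel) (\<lambda>i \<omega>. D \<omega> $$ (i, i)) {..<n} \<and>
     (\<forall>i<n. \<forall>t\<ge>0. cdf (distr M borel (\<lambda>\<omega>. D \<omega> $$ (i, i))) t = 1 - exp (- G t))"

end

theory Submission
  imports Defs "Jordan_Normal_Form.Gram_Schmidt"
begin

text \<open>
  For a fixed vector \<open>w\<close>, independence gives
  \<open>P (D\<^sub>i > t \<bar>w\<^sub>i\<bar> for all i) = exp (- (\<Sum>i. G (t \<bar>w\<^sub>i\<bar>)))\<close>, and by convexity the sum is at least \<open>L\<close>
  once \<open>t\<close> is \<open>2 L\<close> over the Orlicz norm of \<open>w\<close>.  In an orthonormal basis of the column space, the
  vectors of sup norm \<open>1\<close> have coordinates bounded by \<open>n\<close>, so a grid of \<open>n\<^bsup>O(d)\<^esup>\<close> points with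
  polynomially small mesh approximates all of them.  With \<open>L = 32 d ln n\<close> the union bound over the grid
  costs at most \<open>0.01\<close>.  Passing from a grid point to a nearby vector is harmless because, with
  probability \<open>0.99\<close>, all diagonal entries exceed \<open>1 / (100 n)\<close>, and because the Orlicz norm lies
  between the sup norm and \<open>n\<close> times the sup norm.
\<close>

section \<open>Orthonormal bases of column spaces\<close>

text \<open>A vector of \<open>S\<close> outside \<open>span U\<close> could be added to
  \<open>U\<close> without losing independence, against maximality. This links the rank, which is
  the size of such a \<open>U\<close>, to the column space.\<close>

lemma (in vec_space) span_maximal_indpt:
  assumes S: "S \<subseteq> carrier_vec n"
    and max: "maximal U (\<lambda>T. T \<subseteq> S \<and> lin_indpt T)"
  shows "span U = span S"
proof -
  have U: "U \<subseteq> S" "lin_indpt U"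
    using max unfolding maximal_def by auto
  have U': "U \<subseteq> carrier_vec n"
    using U S by auto
  have "s \<in> span U" if s: "s \<in> S" for s
  proof (rule ccontr)
    assume n: "s \<notin> span U"
    hence "s \<notin> U"
      using in_own_span[of U] U' by auto
    moreover have "lin_indpt (U \<union> {s})"
      using lindep_span U U' n s S lin_dep_iff_in_span[OF _ U(2)] \<open>s \<notin> U\<close> by auto
    ultimately show False
      using max U s unfolding maximal_def by blast
  qed
  hence "span S \<subseteq> span U"
    using span_is_subset[OF _ span_is_submodule] U' by (metis subsetI)
  thus ?thesis
    using span_is_monotone[OF U(1)] by auto
qed

text \<open>Gram-Schmidt is applied to a maximal independent set of columns, whose size is the rank.
  The basis is returned as a plain function \<open>B k i\<close>, so that later estimates involve
  finite sums of reals and no carrier conditions.\<close>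

lemma column_space_orthonormal_expansion:
  fixes A :: "real mat"
  assumes A: "A \<in> carrier_mat n m"
  shows "\<exists>B :: nat \<Rightarrow> nat \<Rightarrow> real.
    (\<forall>k<vec_space.rank n A. \<forall>l<vec_space.rank n A.
       (\<Sum>i<n. B k i * B l i) = (if k = l then 1 else 0)) \<and>
    (\<forall>x\<in>carrier_vec m.
       \<exists>z. \<forall>i<n. (A *\<^sub>v x) $ i = (\<Sum>k<vec_space.rank n A. z k * B k i))"
proof -
  interpret cof_vec_space n "TYPE(real)" .
  let ?S = "set (cols A)"
  have S: "?S \<subseteq> carrier_vec n"
    using A cols_dim by blast
  have "lin_indpt {}"
    by (auto simp: lin_dep_def)
  then obtain U where U: "maximal U (\<lambda>T. T \<subseteq> ?S \<and> lin_indpt T)"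
    using maximal_exists_superset[of ?S "\<lambda>T. T \<subseteq> ?S \<and> lin_indpt T" "{}"] by auto
  have card: "rank A = card U"
    using rank_card_indpt[OF A U] .
  have U': "U \<subseteq> ?S" "lin_indpt U"
    using U unfolding maximal_def by auto
  obtain ws where ws: "set ws = U" "distinct ws"
    using finite_distinct_list[of U] U' finite_subset by blast
  define us where "us = gram_schmidt n ws"
  have wsc: "set ws \<subseteq> carrier_vec n" "\<not> lin_dep (set ws)"
    using ws U' S by auto
  note gs = gram_schmidt_result[OF wsc(1) ws(2) wsc(2) us_def]
  have len: "length us = rank A"
    using gs(4) card ws distinct_card by metis
  have usc: "us ! k \<in> carrier_vec n" if "k < rank A" for k
    using gs(3) len that nth_mem by auto
  define g where "g k = scalar_prod (us ! k) (us ! k)" for k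
  have sp: "scalar_prod (us ! k) (us ! l) = (\<Sum>i<n. us ! k $ i * us ! l $ i)" if "k < rank A" "l < rank A" for k l
    using carrier_vecD[OF usc[OF that(2)]] unfolding scalar_prod_def by (simp add: atLeast0LessThan)
  \<comment> \<open>Conjugation is trivial over the reals. The equivalence also says that no
    \<open>us ! k\<close> has length zero, so \<open>g k\<close> can be divided by.\<close>
  have orth: "scalar_prod (us ! k) (us ! l) = 0 \<longleftrightarrow> k \<noteq> l" if "k < rank A" "l < rank A" for k l
    using corthogonalD[OF gs(2), of k l] that len by (simp add: conjugate_vec_def vec_eq_iff)
  have g: "g k > 0" if "k < rank A" for k
  proof -
    have "g k \<noteq> 0"
      using orth[OF that that] by (simp add: g_def)
    moreover have "g k \<ge> 0"
      unfolding g_def sp[OF that that] by (intro sum_nonneg) auto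
    ultimately show ?thesis by simp
  qed
  \<comment> \<open>The vectors in \<open>us\<close> are orthogonal but not normalised; the factor
    \<open>sqrt (g k)\<close> moves into the coefficients below.\<close>
  define B where "B k i = us ! k $ i / sqrt (g k)" for k i
  show ?thesis
  proof (intro exI[of _ B] conjI allI impI ballI)
    fix k l
    assume kl: "k < vec_space.rank n A" "l < vec_space.rank n A"
    have "(\<Sum>i<n. B k i * B l i) = (scalar_prod (us ! k) (us ! l)) / (sqrt (g k) * sqrt (g l))"
      unfolding B_def sp[OF kl] by (simp add: sum_divide_distrib)
    also have "\<dots> = (if k = l then 1 else 0)"
      using g[OF kl(1)] orth[OF kl] by (auto simp: g_def[symmetric])
    finally show "(\<Sum>i<n. B k i * B l i) = (if k = l then 1 else 0)" .
  next
    fix x :: "real vec"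
    assume x: "x \<in> carrier_vec m"
    have "A *\<^sub>v x \<in> col_space A"
      unfolding col_space_eq[OF A] using A x by auto
    hence "A *\<^sub>v x \<in> span (set us)"
      unfolding col_space_def gs(1)[symmetric] ws(1) span_maximal_indpt[OF S U] .
    then obtain a where a: "A *\<^sub>v x = lincomb a (set us)"
      using finite_in_span[of "set us" "A *\<^sub>v x"] gs(3) by (metis List.finite_set)
    have "(A *\<^sub>v x) $ i = (\<Sum>k<rank A. (a (us ! k) * sqrt (g k)) * B k i)" if i: "i < n" for i
    proof -
      have "(A *\<^sub>v x) $ i = (\<Sum>u\<in>set us. a u * u $ i)"
        unfolding a by (rule lincomb_index[OF i gs(3)])
      also have "\<dots> = (\<Sum>k<rank A. a (us ! k) * us ! k $ i)"
        using sum.reindex_bij_betw[OF bij_betw_nth[OF gs(5) refl refl], of "\<lambda>u. a u * u $ i"] len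
        by simp
      also have "\<dots> = (\<Sum>k<rank A. (a (us ! k) * sqrt (g k)) * B k i)"
        using g by (intro sum.cong) (force simp: B_def)+
      finally show ?thesis .
    qed
    thus "\<exists>z. \<forall>i<n. (A *\<^sub>v x) $ i = (\<Sum>k<vec_space.rank n A. z k * B k i)"
      by (intro exI[of _ "\<lambda>k. a (us ! k) * sqrt (g k)"]) auto
  qed
qed

text \<open>Parseval's identity. It will turn a bound on the entries of a vector into a bound on its
  coordinates.\<close>

lemma orthonormal_sum_squares:
  fixes B :: "nat \<Rightarrow> nat \<Rightarrow> real"
  assumes "\<And>k l. k < d \<Longrightarrow> l < d \<Longrightarrow> (\<Sum>i<n. B k i * B l i) = (if k = l then 1 else 0)"
  shows "(\<Sum>i<n. (\<Sum>k<d. z k * B k i)\<^sup>2) = (\<Sum>k<d. (z k)\<^sup>2)"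
proof -
  have "(\<Sum>i<n. (\<Sum>k<d. z k * B k i)\<^sup>2) = (\<Sum>i<n. \<Sum>k<d. \<Sum>l<d. z k * z l * (B k i * B l i))"
    by (simp add: power2_eq_square sum_product mult_ac)
  also have "\<dots> = (\<Sum>k<d. \<Sum>i<n. \<Sum>l<d. z k * z l * (B k i * B l i))"
    by (rule sum.swap)
  also have "\<dots> = (\<Sum>k<d. \<Sum>l<d. \<Sum>i<n. z k * z l * (B k i * B l i))"
    by (intro sum.cong refl sum.swap)
  also have "\<dots> = (\<Sum>k<d. \<Sum>l<d. z k * z l * (if k = l then 1 else 0))"
    by (intro sum.cong refl) (simp add: sum_distrib_left[symmetric] assms)
  also have "\<dots> = (\<Sum>k<d. (z k)\<^sup>2)"
    by (simp add: power2_eq_square if_distrib cong: if_cong)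
  finally show ?thesis .
qed

lemma orthonormal_entry_le_1:
  fixes B :: "nat \<Rightarrow> nat \<Rightarrow> real"
  assumes "(\<Sum>i<n. B k i * B k i) = 1" "i < n"
  shows "\<bar>B k i\<bar> \<le> 1"
proof -
  have "B k i * B k i \<le> (\<Sum>i<n. B k i * B k i)"
    using assms(2) by (intro member_le_sum) auto
  thus ?thesis
    using assms(1) by (simp add: abs_square_le_1[symmetric] power2_eq_square)
qed

section \<open>Orlicz norms\<close>

definition orlicz_sum :: "(real \<Rightarrow> real) \<Rightarrow> nat \<Rightarrow> (nat \<Rightarrow> real) \<Rightarrow> real \<Rightarrow> real" where
  "orlicz_sum G n y \<alpha> = (\<Sum>i<n. G (\<bar>y i\<bar> / \<alpha>))"

definition orlicz_fun :: "(real \<Rightarrow> real) \<Rightarrow> nat \<Rightarrow> (nat \<Rightarrow> real) \<Rightarrow> real" where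
  "orlicz_fun G n y = Inf {\<alpha>. \<alpha> > 0 \<and> orlicz_sum G n y \<alpha> \<le> 1}"

lemma orlicz_norm_eq_orlicz_fun: "orlicz_norm G y = orlicz_fun G (dim_vec y) (\<lambda>i. y $ i)"
  by (simp add: orlicz_norm_def orlicz_fun_def orlicz_sum_def)

text \<open>The positive slope beyond 1 enters through \<open>gt_one\<close>, which makes the Orlicz
  norm dominate the sup norm.\<close>

locale orlicz_function =
  fixes G :: "real \<Rightarrow> real"
  assumes nonneg: "\<And>x. G x \<ge> 0"
    and mono: "\<And>x y. 0 \<le> x \<Longrightarrow> x \<le> y \<Longrightarrow> G x \<le> G y"
    and conv: "convex_on {0..} G"
    and zero: "G 0 = 0"
    and one: "G 1 = 1"
    and gt_one: "\<And>x. x > 1 \<Longrightarrow> G x > 1"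

lemma property_P_orlicz_function:
  assumes "property_P G"
  shows "orlicz_function G"
proof
  obtain s where s: "s > 0" "\<And>x. x > 1 \<Longrightarrow> G x = s * x + (1 - s)"
    using assms unfolding property_P_def by blast
  show "G x > 1" if "x > 1" for x
    using s(2)[OF that] mult_strict_left_mono[OF that s(1)] by simp
  show "G x \<le> G y" if "0 \<le> x" "x \<le> y" for x y
    using assms that unfolding property_P_def mono_on_def by auto
qed (use assms in \<open>auto simp: property_P_def\<close>)

context orlicz_function
begin

lemma convex_combination:
  assumes "0 \<le> u" "0 \<le> v" "u + v = 1" "0 \<le> x" "0 \<le> y"
  shows "G (u * x + v * y) \<le> u * G x + v * G y"
  using conv assms unfolding convex_on_def by simp

text \<open>Convexity between \<open>x\<close> and the point 0, where \<open>G\<close> vanishes.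
  Read backwards, stretching the argument by \<open>L \<ge> 1\<close> multiplies \<open>G\<close> by
  at least \<open>L\<close>.\<close>

lemma scale_le:
  assumes "0 \<le> u" "u \<le> 1" "0 \<le> x"
  shows "G (u * x) \<le> u * G x"
  using convex_combination[of u "1 - u" x 0] assms zero by simp

lemma le_self:
  assumes "0 \<le> x" "x \<le> 1"
  shows "G x \<le> x"
  using scale_le[of x 1] assms one by simp

lemma orlicz_fun_le:
  assumes "\<alpha> > 0" "orlicz_sum G n y \<alpha> \<le> 1"
  shows "orlicz_fun G n y \<le> \<alpha>"
  unfolding orlicz_fun_def using assms by (intro cInf_lower bdd_belowI[of _ 0]) auto

lemma orlicz_sum_gt_one:
  assumes "0 < \<alpha>" "\<alpha> < orlicz_fun G n y"
  shows "orlicz_sum G n y \<alpha> > 1"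
  using orlicz_fun_le[of \<alpha> n y] assms by linarith

text \<open>Each summand is at most \<open>G (1 / n) \<le> 1 / n\<close>. Hence the Orlicz norm is
  at most \<open>n\<close> times any positive bound on the entries.\<close>

lemma orlicz_fun_admissible:
  assumes "n > 0" "\<And>i. i < n \<Longrightarrow> \<bar>y i\<bar> \<le> r" "r > 0"
  shows "orlicz_sum G n y (real n * r) \<le> 1"
proof -
  have "\<bar>y i\<bar> / (real n * r) \<le> 1 / real n" if "i < n" for i
    using assms that by (simp add: field_simps)
  hence "G (\<bar>y i\<bar> / (real n * r)) \<le> 1 / real n" if "i < n" for i
    using mono[of "\<bar>y i\<bar> / (real n * r)" "1 / real n"] le_self[of "1 / real n"] assms that
    by fastforce
  hence "orlicz_sum G n y (real n * r) \<le> (\<Sum>i<n. 1 / real n)"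
    unfolding orlicz_sum_def by (intro sum_mono) auto
  thus ?thesis
    using assms(1) by simp
qed

text \<open>Ensures that the infimum in \<open>orlicz_fun\<close> is taken over a nonempty
  set.\<close>

lemma ex_admissible:
  obtains \<alpha> where "\<alpha> > 0" "orlicz_sum G n y \<alpha> \<le> 1"
proof (cases "n = 0")
  case True
  thus ?thesis
    using that[of 1] by (simp add: orlicz_sum_def)
next
  case False
  define r where "r = 1 + (\<Sum>i<n. \<bar>y i\<bar>)"
  have r: "r > 0"
    unfolding r_def by (intro add_pos_nonneg sum_nonneg) auto
  have "\<bar>y i\<bar> \<le> r" if "i < n" for i
    using member_le_sum[of i "{..<n}" "\<lambda>i. \<bar>y i\<bar>"] that unfolding r_def by auto
  from orlicz_fun_admissible[OF _ this r] False r that[of "real n * r"] show ?thesis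
    by simp
qed

lemma le_orlicz_fun:
  assumes "\<And>\<alpha>. \<alpha> > 0 \<Longrightarrow> orlicz_sum G n y \<alpha> \<le> 1 \<Longrightarrow> r \<le> \<alpha>"
  shows "r \<le> orlicz_fun G n y"
  unfolding orlicz_fun_def
  using ex_admissible[of n y] assms by (intro cInf_greatest) auto

lemma orlicz_fun_nonneg: "orlicz_fun G n y \<ge> 0"
  by (rule le_orlicz_fun) simp

text \<open>For an admissible \<open>\<alpha>\<close> no ratio
  \<open>\<bar>y i\<bar> / \<alpha>\<close> can exceed 1, because that summand alone would exceed
  1.\<close>

lemma abs_le_orlicz_fun:
  assumes "i < n"
  shows "\<bar>y i\<bar> \<le> orlicz_fun G n y"
proof (rule le_orlicz_fun)
  fix \<alpha> :: real
  assume \<alpha>: "\<alpha> > 0" "orlicz_sum G n y \<alpha> \<le> 1"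
  have "G (\<bar>y i\<bar> / \<alpha>) \<le> orlicz_sum G n y \<alpha>"
    unfolding orlicz_sum_def using assms nonneg
    by (intro member_le_sum[where f = "\<lambda>i. G (\<bar>y i\<bar> / \<alpha>)"]) auto
  hence "\<not> \<bar>y i\<bar> / \<alpha> > 1"
    using gt_one[of "\<bar>y i\<bar> / \<alpha>"] \<alpha>(2) by linarith
  thus "\<bar>y i\<bar> \<le> \<alpha>"
    using \<alpha>(1) by (simp add: field_simps)
qed

lemma orlicz_fun_zero:
  assumes "\<And>i. i < n \<Longrightarrow> y i = 0"
  shows "orlicz_fun G n y = 0"
proof -
  have le: "orlicz_fun G n y \<le> \<epsilon>" if "\<epsilon> > 0" for \<epsilon>
    using that assms zero by (intro orlicz_fun_le) (auto simp: orlicz_sum_def)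
  have "orlicz_fun G n y \<le> 0"
    by (rule field_le_epsilon) (simp only: add_0 le)
  thus ?thesis
    using orlicz_fun_nonneg[of n y] by simp
qed

text \<open>The direction of homogeneity that carries a lower bound from a vector rescaled to sup
  norm 1 back to the original.\<close>

lemma orlicz_fun_scale_ge:
  assumes "c > 0"
  shows "c * orlicz_fun G n y \<le> orlicz_fun G n (\<lambda>i. c * y i)"
proof (rule le_orlicz_fun)
  fix \<alpha> :: real
  assume \<alpha>: "\<alpha> > 0" "orlicz_sum G n (\<lambda>i. c * y i) \<alpha> \<le> 1"
  have "orlicz_sum G n y (\<alpha> / c) \<le> 1"
    using \<alpha>(2) assms by (simp add: orlicz_sum_def abs_mult mult_ac)
  from orlicz_fun_le[OF _ this] show "c * orlicz_fun G n y \<le> \<alpha>"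
    using \<alpha>(1) assms by (simp add: field_simps)
qed

text \<open>The triangle inequality, with the norm of \<open>y - w\<close> replaced by its bound
  \<open>n * r\<close>.\<close>

lemma orlicz_fun_perturb:
  assumes n: "n > 0" and r: "r > 0" and close: "\<And>i. i < n \<Longrightarrow> \<bar>y i - w i\<bar> \<le> r"
  shows "orlicz_fun G n y \<le> orlicz_fun G n w + real n * r"
proof -
  have "orlicz_fun G n y - real n * r \<le> orlicz_fun G n w"
  proof (rule le_orlicz_fun)
    fix \<alpha> :: real
    assume \<alpha>: "\<alpha> > 0" "orlicz_sum G n w \<alpha> \<le> 1"
    define \<beta> where "\<beta> = real n * r"
    have \<beta>: "\<beta> > 0"
      using n r by (simp add: \<beta>_def)
    \<comment> \<open>The usual weights: scaling by \<open>\<alpha> + \<beta>\<close> is a convex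
      combination of scaling \<open>w\<close> by \<open>\<alpha>\<close> and \<open>y - w\<close> by
      \<open>\<beta>\<close>.\<close>
    define u v where "u = \<alpha> / (\<alpha> + \<beta>)" and "v = \<beta> / (\<alpha> + \<beta>)"
    have uv: "u \<ge> 0" "v \<ge> 0" "u + v = 1"
      using \<alpha>(1) \<beta> by (auto simp: u_def v_def add_divide_distrib[symmetric])
    have "orlicz_sum G n y (\<alpha> + \<beta>) \<le> (\<Sum>i<n. u * G (\<bar>w i\<bar> / \<alpha>) + v * G (\<bar>y i - w i\<bar> / \<beta>))"
      unfolding orlicz_sum_def
    proof (rule sum_mono)
      fix i
      have "\<bar>y i\<bar> / (\<alpha> + \<beta>) \<le> (\<bar>w i\<bar> + \<bar>y i - w i\<bar>) / (\<alpha> + \<beta>)"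
        using \<alpha>(1) \<beta> by (intro divide_right_mono) auto
      also have "\<dots> = u * (\<bar>w i\<bar> / \<alpha>) + v * (\<bar>y i - w i\<bar> / \<beta>)"
        using \<alpha>(1) \<beta> by (simp add: u_def v_def add_divide_distrib)
      finally have "G (\<bar>y i\<bar> / (\<alpha> + \<beta>)) \<le> G (u * (\<bar>w i\<bar> / \<alpha>) + v * (\<bar>y i - w i\<bar> / \<beta>))"
        using \<alpha>(1) \<beta> by (intro mono) auto
      also have "\<dots> \<le> u * G (\<bar>w i\<bar> / \<alpha>) + v * G (\<bar>y i - w i\<bar> / \<beta>)"
        using \<alpha>(1) \<beta> uv by (intro convex_combination) auto
      finally show "G (\<bar>y i\<bar> / (\<alpha> + \<beta>)) \<le> u * G (\<bar>w i\<bar> / \<alpha>) + v * G (\<bar>y i - w i\<bar> / \<beta>)" .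
    qed
    also have "\<dots> = u * orlicz_sum G n w \<alpha> + v * orlicz_sum G n (\<lambda>i. y i - w i) \<beta>"
      by (simp add: orlicz_sum_def sum.distrib sum_distrib_left)
    also have "\<dots> \<le> u * 1 + v * 1"
      using \<alpha>(2) orlicz_fun_admissible[of n "\<lambda>i. y i - w i" r] n r close uv
      by (intro add_mono mult_left_mono) (auto simp: \<beta>_def)
    finally have "orlicz_sum G n y (\<alpha> + \<beta>) \<le> 1"
      using uv by simp
    from orlicz_fun_le[OF _ this] \<alpha>(1) \<beta> show "orlicz_fun G n y - real n * r \<le> \<alpha>"
      by (simp add: \<beta>_def)
  qed
  thus ?thesis by simp
qed

text \<open>Half the norm lies strictly below the infimum, so the sum there exceeds 1; stretching
  the arguments by \<open>L\<close> then raises it to at least \<open>L\<close>.\<close>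

lemma orlicz_sum_amplified:
  assumes "L \<ge> 1" "orlicz_fun G n w > 0"
  shows "(\<Sum>i<n. G (2 * L * \<bar>w i\<bar> / orlicz_fun G n w)) \<ge> L"
proof -
  let ?N = "orlicz_fun G n w"
  have "L \<le> L * orlicz_sum G n w (?N / 2)"
    using orlicz_sum_gt_one[of "?N / 2" n w] assms by auto
  also have "\<dots> = (\<Sum>i<n. L * G (2 * \<bar>w i\<bar> / ?N))"
    by (simp add: orlicz_sum_def sum_distrib_left mult_ac)
  also have "\<dots> \<le> (\<Sum>i<n. G (2 * L * \<bar>w i\<bar> / ?N))"
  proof (rule sum_mono)
    fix i
    have "G (2 * \<bar>w i\<bar> / ?N) \<le> 1 / L * G (2 * L * \<bar>w i\<bar> / ?N)"
      using scale_le[of "1 / L" "2 * L * \<bar>w i\<bar> / ?N"] assms by simp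
    thus "L * G (2 * \<bar>w i\<bar> / ?N) \<le> G (2 * L * \<bar>w i\<bar> / ?N)"
      using assms by (simp add: field_simps)
  qed
  finally show ?thesis .
qed

end

section \<open>Passing from a net point to a nearby vector\<close>

text \<open>Sup norm at least 1 forces Orlicz norm at least 1, so replacing \<open>y\<close> by
  \<open>w\<close> changes the norm by a negligible 1/800. The lower bound on \<open>X\<close> keeps
  the error in each ratio below \<open>100 n / (800 n L) = 1 / (8 L)\<close>.\<close>

lemma (in orlicz_function) net_point_suffices:
  assumes n: "n > 0" and L: "L \<ge> 1"
    and X: "\<And>i. i < n \<Longrightarrow> X i > 1 / (100 * real n)"
    and y: "j < n" "\<bar>y j\<bar> = 1"
    and close: "\<And>i. i < n \<Longrightarrow> \<bar>y i - w i\<bar> \<le> 1 / (800 * real n * L)"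
    and net: "orlicz_fun G n w > 0 \<Longrightarrow> \<exists>i<n. X i \<le> 2 * L * \<bar>w i\<bar> / orlicz_fun G n w"
  shows "\<exists>i<n. orlicz_fun G n y / (8 * L) \<le> \<bar>y i\<bar> / X i"
proof -
  let ?N = "orlicz_fun G n y" and ?W = "orlicz_fun G n w"
  have N: "?N \<ge> 1"
    using abs_le_orlicz_fun[OF y(1), of y] y(2) by simp
  have "?N \<le> ?W + real n * (1 / (800 * real n * L))"
    using n L close by (intro orlicz_fun_perturb) auto
  also have "real n * (1 / (800 * real n * L)) = 1 / (800 * L)"
    using n by simp
  also have "\<dots> \<le> 1 / 800"
    using L by (simp add: field_simps)
  finally have W: "?N \<le> ?W + 1 / 800" by simp
  with N have "?W > 0" by simp
  from net[OF this] obtain i where i: "i < n" "X i \<le> 2 * L * \<bar>w i\<bar> / ?W"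
    by blast
  have Xi: "X i > 1 / (100 * real n)" "X i > 0"
    using X[OF i(1)] n by (auto intro: less_trans[rotated])
  have "?W / (2 * L) \<le> \<bar>w i\<bar> / X i"
    using i(2) Xi(2) \<open>?W > 0\<close> L by (simp add: field_simps)
  also have "\<dots> \<le> \<bar>y i\<bar> / X i + \<bar>y i - w i\<bar> / X i"
    unfolding add_divide_distrib[symmetric] using Xi(2) by (intro divide_right_mono) auto
  also have "\<bar>y i - w i\<bar> / X i \<le> (1 / (800 * real n * L)) / (1 / (100 * real n))"
    using close[OF i(1)] Xi n L by (intro frac_le) auto
  also have "\<dots> = 1 / (8 * L)"
    using n L by (simp add: field_simps)
  finally have "?W / (2 * L) - 1 / (8 * L) \<le> \<bar>y i\<bar> / X i"
    by simp
  \<comment> \<open>After multiplication by \<open>8 * L\<close> this reads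
    \<open>?N \<le> 4 * ?W - 1\<close>, which follows from \<open>?N \<ge> 1\<close> and
    \<open>?W \<ge> ?N - 1 / 800\<close>.\<close>
  moreover have "?N / (8 * L) \<le> ?W / (2 * L) - 1 / (8 * L)"
    using W N L by (simp add: field_simps)
  ultimately show ?thesis
    using i(1) by (intro exI[of _ i]) auto
qed

section \<open>Independent variables with distribution function \<open>1 - exp (- G t)\<close>\<close>

locale orlicz_variables = prob_space M + orlicz_function G
  for M :: "'a measure" and G :: "real \<Rightarrow> real" +
  fixes n :: nat and X :: "nat \<Rightarrow> 'a \<Rightarrow> real"
  assumes indep: "indep_vars (\<lambda>_. borel) X {..<n}"
    and cdf: "\<And>i t. i < n \<Longrightarrow> t \<ge> 0 \<Longrightarrow> cdf (distr M borel (X i)) t = 1 - exp (- G t)"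
begin

lemma measurable_X: "i < n \<Longrightarrow> X i \<in> borel_measurable M"
  using indep unfolding indep_vars_def by auto

lemma prob_le:
  assumes "i < n" "t \<ge> 0"
  shows "prob {\<omega> \<in> space M. X i \<omega> \<le> t} = 1 - exp (- G t)"
proof -
  have "prob {\<omega> \<in> space M. X i \<omega> \<le> t} = measure (distr M borel (X i)) {..t}"
    using measurable_X[OF assms(1)] by (subst measure_distr) (auto intro!: arg_cong[where f = prob])
  thus ?thesis
    using cdf[OF assms] by (simp add: cdf_def)
qed

lemma prob_gt:
  assumes "i < n" "t \<ge> 0"
  shows "prob {\<omega> \<in> space M. X i \<omega> > t} = exp (- G t)"
proof -
  note [measurable] = measurable_X[OF assms(1)]
  have "prob {\<omega> \<in> space M. \<not> X i \<omega> \<le> t} = 1 - prob {\<omega> \<in> space M. X i \<omega> \<le> t}"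
    by (intro prob_neg) measurable
  thus ?thesis
    using prob_le[OF assms] by (simp add: not_le)
qed

lemma prob_all_gt:
  assumes "n > 0" "\<And>i. i < n \<Longrightarrow> t i \<ge> 0"
  shows "prob {\<omega> \<in> space M. \<forall>i<n. X i \<omega> > t i} = exp (- (\<Sum>i<n. G (t i)))"
proof -
  \<comment> \<open>Here \<open>n > 0\<close> matters: an empty intersection would be the whole type
    instead of \<open>space M\<close>.\<close>
  have "{\<omega> \<in> space M. \<forall>i<n. X i \<omega> > t i} = (\<Inter>i\<in>{..<n}. X i -` {t i<..} \<inter> space M)"
    using assms(1) by auto
  also have "prob \<dots> = (\<Prod>i<n. prob (X i -` {t i<..} \<inter> space M))"
    using assms(1) by (intro indep_varsD[OF indep]) auto
  also have "\<dots> = (\<Prod>i<n. exp (- G (t i)))"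
    using assms(2) prob_gt
    by (intro prod.cong refl) (auto simp: vimage_def Int_def conj_commute)
  finally show ?thesis
    by (simp add: exp_sum[symmetric] sum_negf)
qed

text \<open>Union bound with \<open>1 - exp (- G t) \<le> G t \<le> t\<close>. At
  \<open>t = 1 / (100 n)\<close> it costs 0.01; at \<open>t = 0\<close> it gives almost sure
  positivity.\<close>

lemma prob_some_le:
  assumes "0 \<le> t" "t \<le> 1"
  shows "prob {\<omega> \<in> space M. \<exists>i<n. X i \<omega> \<le> t} \<le> real n * t"
proof -
  have "{\<omega> \<in> space M. \<exists>i<n. X i \<omega> \<le> t} = (\<Union>i\<in>{..<n}. {\<omega> \<in> space M. X i \<omega> \<le> t})"
    by auto
  also have "prob \<dots> \<le> (\<Sum>i<n. prob {\<omega> \<in> space M. X i \<omega> \<le> t})"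
    using measurable_X by (intro finite_measure_subadditive_finite) auto
  also have "\<dots> \<le> (\<Sum>i<n. t)"
  proof (rule sum_mono)
    fix i assume "i \<in> {..<n}"
    moreover have "1 - exp (- G t) \<le> G t"
      using exp_ge_add_one_self[of "- G t"] by simp
    ultimately show "prob {\<omega> \<in> space M. X i \<omega> \<le> t} \<le> t"
      using prob_le[of i t] le_self[OF assms] assms(1) by simp
  qed
  finally show ?thesis by simp
qed

lemma AE_pos: "AE \<omega> in M. \<forall>i<n. X i \<omega> > 0"
proof -
  have "{\<omega> \<in> space M. \<exists>i<n. X i \<omega> \<le> 0} \<in> events"
    using measurable_X by measurable
  moreover have "prob {\<omega> \<in> space M. \<exists>i<n. X i \<omega> \<le> 0} = 0"
    using prob_some_le[of 0] by (intro antisym measure_nonneg) auto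
  ultimately have "AE \<omega> in M. \<omega> \<notin> {\<omega> \<in> space M. \<exists>i<n. X i \<omega> \<le> 0}"
    by (simp only: prob_eq_0)
  with AE_space show ?thesis
    by eventually_elim (auto simp: not_le)
qed

text \<open>For one point of positive norm the failure probability is the exponential of minus an
  amplified sum, hence at most \<open>exp (- L)\<close>; a union bound over \<open>F\<close>
  follows.\<close>

lemma prob_net_failure:
  assumes n: "n > 0" and L: "L \<ge> 1" and F: "finite F"
  shows "prob {\<omega> \<in> space M. \<exists>f\<in>F. orlicz_fun G n (w f) > 0 \<and>
      (\<forall>i<n. X i \<omega> > 2 * L * \<bar>w f i\<bar> / orlicz_fun G n (w f))} \<le> real (card F) * exp (- L)"
proof -
  let ?F = "{f \<in> F. orlicz_fun G n (w f) > 0}"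
  let ?E = "\<lambda>f. {\<omega> \<in> space M. \<forall>i<n. X i \<omega> > 2 * L * \<bar>w f i\<bar> / orlicz_fun G n (w f)}"
  have eq: "{\<omega> \<in> space M. \<exists>f\<in>F. orlicz_fun G n (w f) > 0 \<and>
      (\<forall>i<n. X i \<omega> > 2 * L * \<bar>w f i\<bar> / orlicz_fun G n (w f))} = (\<Union>f\<in>?F. ?E f)"
    by auto
  have "prob (\<Union>f\<in>?F. ?E f) \<le> (\<Sum>f\<in>?F. prob (?E f))"
  proof (intro finite_measure_subadditive_finite)
    show "?E ` ?F \<subseteq> events"
      using measurable_X by (intro image_subsetI) measurable
  qed (use F in auto)
  also have "\<dots> \<le> (\<Sum>f\<in>?F. exp (- L))"
  proof (rule sum_mono)
    fix f assume "f \<in> ?F"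
    hence f: "orlicz_fun G n (w f) > 0" by simp
    show "prob (?E f) \<le> exp (- L)"
      using orlicz_sum_amplified[OF L f] L f n by (subst prob_all_gt) auto
  qed
  also have "\<dots> \<le> (\<Sum>f\<in>F. exp (- L))"
    using F by (intro sum_mono2) auto
  finally show ?thesis
    unfolding eq by simp
qed

end

section \<open>The grid\<close>

lemma exp_times_ln: "x > 0 \<Longrightarrow> exp (real k * ln x) = x ^ k"
  by (simp add: exp_of_nat_mult)

text \<open>Since \<open>51201 \<le> 2 ^ 16 \<le> n ^ 16\<close>, the grid has at most
  \<open>n ^ (21 d)\<close> points, while the exponential equals \<open>n ^ (- 32 d)\<close>. The
  product is at most \<open>n ^ (- 11 d) \<le> 2 ^ (- 11)\<close>; the factor 32 is chosen to leave
  this room.\<close>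

lemma grid_card_bound:
  assumes n: "n \<ge> (2::nat)" and d: "d \<ge> (1::nat)"
  shows "real ((2 * (25600 * n ^ 5) + 1) ^ d) * exp (- (32 * real d * ln (real n))) \<le> 1 / 100"
proof -
  have n0: "real n \<ge> 2" using n by simp
  have "real (2 * (25600 * n ^ 5) + 1) \<le> 2 ^ 16 * real n ^ 5"
  proof -
    have "1 \<le> real n ^ 5"
      using n0 by (intro one_le_power) simp
    thus ?thesis by simp
  qed
  also have "\<dots> \<le> real n ^ 16 * real n ^ 5"
    using n0 by (intro mult_right_mono power_mono) auto
  also have "\<dots> = real n ^ 21"
    by (simp add: power_add[symmetric])
  finally have "real ((2 * (25600 * n ^ 5) + 1) ^ d) \<le> (real n ^ 21) ^ d"
    unfolding of_nat_power by (intro power_mono) auto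
  moreover have "exp (- (32 * real d * ln (real n))) = 1 / real n ^ (32 * d)"
    using exp_times_ln[of "real n" "32 * d"] n0 by (simp add: exp_minus inverse_eq_divide)
  ultimately have "real ((2 * (25600 * n ^ 5) + 1) ^ d) * exp (- (32 * real d * ln (real n)))
      \<le> (real n ^ 21) ^ d * (1 / real n ^ (32 * d))"
    by (metis (no_types) mult_right_mono exp_ge_zero)
  also have "\<dots> = 1 / real n ^ (11 * d)"
  proof -
    have "real n ^ (32 * d) = (real n ^ 21) ^ d * real n ^ (11 * d)"
      by (simp add: power_mult[symmetric] power_add[symmetric])
    thus ?thesis using n0 by simp
  qed
  also have "\<dots> \<le> 1 / 2 ^ 11"
  proof -
    have "(2::real) ^ 11 \<le> 2 ^ (11 * d)"
      using d by (intro power_increasing) auto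
    also have "\<dots> \<le> real n ^ (11 * d)"
      using n0 by (intro power_mono) auto
    finally show ?thesis using n0 by (intro divide_left_mono) auto
  qed
  finally show ?thesis by simp
qed

text \<open>Coordinates are rounded down to multiples of \<open>1 / S\<close>. Each of the
  \<open>d\<close> roundings moves an entry by at most \<open>1 / S\<close>, because the entries of
  \<open>B\<close> are at most 1, and \<open>d / S = 1 / (800 n L)\<close>.\<close>

lemma grid_approximation:
  fixes B :: "nat \<Rightarrow> nat \<Rightarrow> real" and z :: "nat \<Rightarrow> real" and d :: nat
  defines "y \<equiv> \<lambda>i. \<Sum>k<d. z k * B k i"
  assumes d: "0 < d" "d \<le> n" and L: "0 < L" "L \<le> 32 * real d * real n"
    and B: "\<And>k l. k < d \<Longrightarrow> l < d \<Longrightarrow> (\<Sum>i<n. B k i * B l i) = (if k = l then 1 else 0)"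
    and y: "\<And>i. i < n \<Longrightarrow> \<bar>y i\<bar> \<le> 1"
  obtains f where "f \<in> {..<d} \<rightarrow>\<^sub>E {- int (25600 * n ^ 5)..int (25600 * n ^ 5)}"
    "\<And>i. i < n \<Longrightarrow>
       \<bar>y i - (\<Sum>k<d. of_int (f k) / (800 * real n * real d * L) * B k i)\<bar> \<le> 1 / (800 * real n * L)"
proof -
  define S where "S = 800 * real n * real d * L"
  have S: "S > 0"
    using d L by (simp add: S_def)
  \<comment> \<open>The restriction makes \<open>f\<close> an element of the extensional function
    space, which is finite.\<close>
  define f where "f = restrict (\<lambda>k. \<lfloor>z k * S\<rfloor>) {..<d}"
  \<comment> \<open>Parseval gives \<open>sqrt n\<close>; the cruder \<open>n\<close> keeps the grid
    size a polynomial in \<open>n\<close>.\<close>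
  have z: "\<bar>z k\<bar> \<le> real n" if "k < d" for k
  proof -
    have "(z k)\<^sup>2 \<le> (\<Sum>k<d. (z k)\<^sup>2)"
      using that by (intro member_le_sum[where f = "\<lambda>k. (z k)\<^sup>2"]) auto
    also have "\<dots> = (\<Sum>i<n. (y i)\<^sup>2)"
      unfolding y_def using B by (intro orthonormal_sum_squares[symmetric]) auto
    also have "\<dots> \<le> (\<Sum>i<n. 1)"
      using y by (intro sum_mono) (simp add: abs_square_le_1)
    also have "\<dots> \<le> (real n)\<^sup>2"
      using d by (simp add: power2_eq_square)
    finally show ?thesis
      by (simp add: abs_le_square_iff[symmetric])
  qed
  \<comment> \<open>The range of the grid: \<open>25600 = 800 * 32\<close>, and the power 5 comes
    from \<open>n ^ 3 * d ^ 2\<close> with \<open>d \<le> n\<close>.\<close>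
  have nS: "real n * S \<le> real (25600 * n ^ 5)"
  proof -
    have "real n * S \<le> real n * (800 * real n * real d * (32 * real d * real n))"
      unfolding S_def using L by (intro mult_left_mono) auto
    also have "\<dots> = 25600 * real n ^ 3 * real d ^ 2"
      by (simp add: power2_eq_square power3_eq_cube)
    also have "\<dots> \<le> 25600 * real n ^ 3 * real n ^ 2"
      using d by (intro mult_left_mono power_mono) auto
    also have "\<dots> = real (25600 * n ^ 5)"
      by (simp add: power_add[symmetric])
    finally show ?thesis .
  qed
  have "f k \<in> {- int (25600 * n ^ 5)..int (25600 * n ^ 5)}" if "k < d" for k
  proof -
    have "\<bar>z k * S\<bar> \<le> real n * S"
      using z[OF that] S by (simp add: abs_mult)
    hence *: "\<bar>z k * S\<bar> \<le> of_int (int (25600 * n ^ 5))"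
      using nS by simp
    have "- int (25600 * n ^ 5) \<le> \<lfloor>z k * S\<rfloor>"
      using * unfolding le_floor_iff of_int_minus by linarith
    moreover have "\<lfloor>z k * S\<rfloor> \<le> int (25600 * n ^ 5)"
      using * of_int_floor_le[of "z k * S"] by linarith
    ultimately show ?thesis
      using that by (simp add: f_def)
  qed
  hence "f \<in> {..<d} \<rightarrow>\<^sub>E {- int (25600 * n ^ 5)..int (25600 * n ^ 5)}"
    unfolding f_def by (auto simp: PiE_iff)
  moreover have "\<bar>y i - (\<Sum>k<d. of_int (f k) / S * B k i)\<bar> \<le> 1 / (800 * real n * L)" if i: "i < n" for i
  proof -
    have "\<bar>y i - (\<Sum>k<d. of_int (f k) / S * B k i)\<bar> = \<bar>\<Sum>k<d. (z k - of_int (f k) / S) * B k i\<bar>"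
      by (simp add: y_def sum_subtractf[symmetric] algebra_simps)
    also have "\<dots> \<le> (\<Sum>k<d. \<bar>(z k - of_int (f k) / S) * B k i\<bar>)"
      by (rule sum_abs)
    also have "\<dots> \<le> (\<Sum>k<d. 1 / S * 1)"
      unfolding abs_mult
    proof (intro sum_mono mult_mono)
      fix k assume k: "k \<in> {..<d}"
      show "\<bar>B k i\<bar> \<le> 1"
        using B[of k k] k i by (intro orthonormal_entry_le_1) auto
      have "z k - of_int (f k) / S = (z k * S - of_int \<lfloor>z k * S\<rfloor>) / S"
        using k S by (simp add: f_def diff_divide_distrib)
      moreover have "\<bar>z k * S - of_int \<lfloor>z k * S\<rfloor>\<bar> \<le> 1"
        by linarith
      ultimately show "\<bar>z k - of_int (f k) / S\<bar> \<le> 1 / S"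
        using S by (simp add: abs_divide divide_right_mono)
    qed (use S in auto)
    also have "\<dots> = 1 / (800 * real n * L)"
      using d by (simp add: S_def)
    finally show ?thesis .
  qed
  ultimately show ?thesis
    using that unfolding S_def by blast
qed

section \<open>The lower bound on a whole subspace\<close>

text \<open>The event excludes a tiny diagonal entry (\<open>E1\<close>) and a failing grid point
  (\<open>E2\<close>), each of probability at most 0.01. Off these, every vector is scaled to sup
  norm 1, rounded to the grid and scaled back. The constant is \<open>256 = 8 * 32\<close>, from
  \<open>8 * L\<close>.\<close>

lemma (in orlicz_variables) subspace_domination:
  fixes B :: "nat \<Rightarrow> nat \<Rightarrow> real"
  assumes n: "2 \<le> n" and d: "0 < d" "d \<le> n"
    and B: "\<And>k l. k < d \<Longrightarrow> l < d \<Longrightarrow> (\<Sum>i<n. B k i * B l i) = (if k = l then 1 else 0)"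
  shows "\<exists>E\<in>events. prob E \<ge> 98 / 100 \<and> (\<forall>\<omega>\<in>E. (\<forall>i<n. X i \<omega> > 0) \<and>
    (\<forall>y z. (\<forall>i<n. y i = (\<Sum>k<d. z k * B k i)) \<longrightarrow>
       (\<exists>i<n. orlicz_fun G n y / (256 * real d * ln (real n)) \<le> \<bar>y i\<bar> / X i \<omega>)))"
proof -
  define L where "L = 32 * real d * ln (real n)"
  define F where "F = {..<d} \<rightarrow>\<^sub>E {- int (25600 * n ^ 5)..int (25600 * n ^ 5)}"
  define w where "w f i = (\<Sum>k<d. of_int (f k) / (800 * real n * real d * L) * B k i)"
    for f :: "nat \<Rightarrow> int" and i
  define E1 where "E1 = {\<omega> \<in> space M. \<exists>i<n. X i \<omega> \<le> 1 / (100 * real n)}"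
  define E2 where "E2 = {\<omega> \<in> space M. \<exists>f\<in>F. orlicz_fun G n (w f) > 0 \<and>
      (\<forall>i<n. X i \<omega> > 2 * L * \<bar>w f i\<bar> / orlicz_fun G n (w f))}"
  have L1: "L \<ge> 1"
  proof -
    have "1 / 2 \<le> ln (2::real)"
      using ln2_ge_two_thirds by simp
    also have "\<dots> \<le> ln (real n)"
      using n by simp
    finally have "1 * (1 / 2) \<le> real d * ln (real n)"
      using d by (intro mult_mono) auto
    thus ?thesis by (simp add: L_def)
  qed
  \<comment> \<open>Bounding the logarithm by \<open>n\<close> makes the grid range an integer
    polynomial in \<open>n\<close>.\<close>
  have L2: "L \<le> 32 * real d * real n"
    unfolding L_def using ln_le_minus_one[of "real n"] n by (intro mult_left_mono) auto
  have "card {- int K..int K} = nat (int (2 * K + 1))" for K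
    unfolding card_atLeastAtMost_int by (rule arg_cong[where f = nat]) simp
  hence F: "finite F" "card F = (2 * (25600 * n ^ 5) + 1) ^ d"
    unfolding F_def by (simp_all only: card_PiE prod_constant card_lessThan nat_int finite_PiE
      finite_lessThan finite_atLeastAtMost_int)
  have ev: "E1 \<in> events" "E2 \<in> events"
    unfolding E1_def E2_def using measurable_X F(1) by measurable
  have p1: "prob E1 \<le> 1 / 100"
    unfolding E1_def using prob_some_le[of "1 / (100 * real n)"] n by (simp add: field_simps)
  have p2: "prob E2 \<le> 1 / 100"
  proof -
    have "prob E2 \<le> real (card F) * exp (- L)"
      unfolding E2_def using n L1 F(1) by (intro prob_net_failure) auto
    also have "\<dots> \<le> 1 / 100"
      unfolding F(2) L_def using n d by (intro grid_card_bound) auto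
    finally show ?thesis .
  qed
  show ?thesis
  proof (intro bexI[of _ "space M - (E1 \<union> E2)"] conjI ballI allI impI)
    show "space M - (E1 \<union> E2) \<in> events"
      using ev by auto
    have "prob (E1 \<union> E2) \<le> prob E1 + prob E2"
      using ev by (intro measure_Un_le)
    thus "prob (space M - (E1 \<union> E2)) \<ge> 98 / 100"
      using prob_compl[of "E1 \<union> E2"] ev p1 p2 by simp
  next
    fix \<omega> i assume "\<omega> \<in> space M - (E1 \<union> E2)" "i < n"
    hence "X i \<omega> > 1 / (100 * real n)"
      by (auto simp: E1_def not_le)
    moreover have "1 / (100 * real n) \<ge> 0"
      by simp
    ultimately show "X i \<omega> > 0"
      by linarith
  next
    fix \<omega> y z assume \<omega>: "\<omega> \<in> space M - (E1 \<union> E2)"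
      and y: "\<forall>i<n. y i = (\<Sum>k<d. z k * B k i)"
    have X: "X i \<omega> > 1 / (100 * real n)" if "i < n" for i
      using \<omega> that by (auto simp: E1_def not_le)
    have net: "\<exists>i<n. X i \<omega> \<le> 2 * L * \<bar>w f i\<bar> / orlicz_fun G n (w f)"
      if "f \<in> F" "orlicz_fun G n (w f) > 0" for f
      using \<omega> that by (auto simp: E2_def not_less)
    have "\<exists>i<n. orlicz_fun G n y / (8 * L) \<le> \<bar>y i\<bar> / X i \<omega>"
    proof (cases "\<forall>i<n. y i = 0")
      \<comment> \<open>The zero vector cannot be normalised, but both sides vanish at any
        index.\<close>
      case True
      thus ?thesis
        using orlicz_fun_zero[of n y] n by (intro exI[of _ 0]) auto
    next
      case False
      define r where "r = Max ((\<lambda>i. \<bar>y i\<bar>) ` {..<n})"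
      have le: "\<bar>y i\<bar> \<le> r" if "i < n" for i
        unfolding r_def using that by (intro Max_ge) auto
      have "r \<in> (\<lambda>i. \<bar>y i\<bar>) ` {..<n}"
        unfolding r_def using n by (intro Max_in) (auto simp: lessThan_empty_iff bot_nat_def)
      then obtain j where j: "j < n" "\<bar>y j\<bar> = r"
        by auto
      have r: "r > 0"
        using False le by force
      define v where "v i = (\<Sum>k<d. (z k / r) * B k i)" for i
      have v: "v i = y i / r" if "i < n" for i
        using y that by (simp add: v_def sum_divide_distrib)
      have "\<bar>v i\<bar> \<le> 1" if "i < n" for i
        using le[OF that] v[OF that] r by simp
      then obtain f where f: "f \<in> F" "\<And>i. i < n \<Longrightarrow> \<bar>v i - w f i\<bar> \<le> 1 / (800 * real n * L)"
        using grid_approximation[OF d _ L2 B, of "\<lambda>k. z k / r"] L1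
        unfolding F_def w_def v_def by auto
      have "\<exists>i<n. orlicz_fun G n v / (8 * L) \<le> \<bar>v i\<bar> / X i \<omega>"
      proof (rule net_point_suffices[where w = "w f" and j = j])
        show "\<bar>v j\<bar> = 1"
          using v[OF j(1)] j(2) r by simp
      qed (use n L1 X j f net in auto)
      then obtain i where i: "i < n" "orlicz_fun G n v / (8 * L) \<le> \<bar>v i\<bar> / X i \<omega>"
        by blast
      have "1 / r * orlicz_fun G n y \<le> orlicz_fun G n (\<lambda>i. 1 / r * y i)"
        using r by (intro orlicz_fun_scale_ge) auto
      also have "\<dots> = orlicz_fun G n v"
        using v by (simp add: orlicz_fun_def orlicz_sum_def)
      finally have "orlicz_fun G n y / r / (8 * L) \<le> orlicz_fun G n v / (8 * L)"
        using L1 by (intro divide_right_mono) auto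
      also note i(2)
      also have "\<bar>v i\<bar> / X i \<omega> = \<bar>y i\<bar> / X i \<omega> / r"
        using v[OF i(1)] r by simp
      finally have "orlicz_fun G n y / (8 * L) / r \<le> \<bar>y i\<bar> / X i \<omega> / r"
        by (simp add: mult_ac)
      hence "orlicz_fun G n y / (8 * L) \<le> \<bar>y i\<bar> / X i \<omega>"
        using r by (simp only: divide_le_cancel)
      thus ?thesis
        using i(1) by blast
    qed
    thus "\<exists>i<n. orlicz_fun G n y / (256 * real d * ln (real n)) \<le> \<bar>y i\<bar> / X i \<omega>"
      by (simp add: L_def mult.assoc)
  qed
qed

section \<open>Inverse diagonal matrices and measurability\<close>

text \<open>The entries of \<open>D * B\<close> are those of \<open>B\<close> with row
  \<open>i\<close> scaled by \<open>D $$ (i, i)\<close>, which determines the inverse. The predicate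
  \<open>P\<close> lets the existential over the inverse be rewritten in one step.\<close>

lemma mat_inverse_diagonal:
  fixes D :: "real mat"
  assumes D: "D \<in> carrier_mat n n" "diagonal_mat D"
  shows "(\<exists>D'. mat_inverse D = Some D' \<and> P D') \<longleftrightarrow>
    (\<forall>i<n. D $$ (i, i) \<noteq> 0) \<and> P (mat n n (\<lambda>(i, j). if i = j then 1 / D $$ (i, i) else 0))"
proof -
  let ?E = "mat n n (\<lambda>(i, j). if i = j then 1 / D $$ (i, i) else 0) :: real mat"
  have entry: "(D * B) $$ (i, j) = D $$ (i, i) * B $$ (i, j)"
    if "B \<in> carrier_mat n n" "i < n" "j < n" for B i j
  proof -
    have "(D * B) $$ (i, j) = (\<Sum>k<n. D $$ (i, k) * B $$ (k, j))"
      using D that by (simp add: scalar_prod_def atLeast0LessThan)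
    also have "\<dots> = (\<Sum>k<n. if k = i then D $$ (i, i) * B $$ (i, j) else 0)"
      using D that by (intro sum.cong) (auto simp: diagonal_mat_def)
    finally show ?thesis using that by simp
  qed
  have inv: "(\<forall>i<n. D $$ (i, i) \<noteq> 0) \<and> D' = ?E" if "mat_inverse D = Some D'" for D'
  proof -
    from mat_inverse(2)[OF D(1) that] have D': "D * D' = 1\<^sub>m n" "D' \<in> carrier_mat n n"
      by auto
    have e: "D $$ (i, i) * D' $$ (i, j) = (if i = j then 1 else 0)" if "i < n" "j < n" for i j
      using entry[OF D'(2) that] D'(1) that by simp
    have nz: "D $$ (i, i) \<noteq> 0" if "i < n" for i
      using e[OF that that] by auto
    have "D' $$ (i, j) = ?E $$ (i, j)" if "i < n" "j < n" for i j
      using e[OF that] nz[OF that(1)] that by (cases "i = j") (simp_all add: field_simps)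
    hence "D' = ?E"
      using D'(2) by (intro eq_matI) auto
    with nz show ?thesis by blast
  qed
  \<comment> \<open>\<open>mat_inverse\<close> fails only on non-units, and the diagonal matrix of
    reciprocals is a two-sided inverse.\<close>
  moreover have "\<exists>D'. mat_inverse D = Some D'" if nz: "\<forall>i<n. D $$ (i, i) \<noteq> 0"
  proof (rule ccontr)
    assume "\<not> ?thesis"
    hence "D \<notin> Units (ring_mat TYPE(real) n ())"
      by (intro mat_inverse(1)[OF D(1)]) auto
    moreover have "(D * ?E) $$ (i, j) = 1\<^sub>m n $$ (i, j)" if "i < n" "j < n" for i j
      using entry[OF _ that, of ?E] nz that by simp
    hence "D * ?E = 1\<^sub>m n"
      using D(1) by (intro eq_matI) auto
    hence "D \<in> Units (ring_mat TYPE(real) n ())"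
      using D(1) mat_mult_left_right_inverse[OF D(1), of ?E]
      unfolding Units_def ring_mat_def by (auto intro!: bexI[of _ ?E])
    ultimately show False by blast
  qed
  ultimately show ?thesis by blast
qed

lemma linf_norm_diagonal:
  fixes v :: "nat \<Rightarrow> real"
  assumes "y \<in> carrier_vec n"
  shows "linf_norm (mat n n (\<lambda>(i, j). if i = j then v i else 0) *\<^sub>v y)
    = Max (insert 0 ((\<lambda>i. \<bar>v i * y $ i\<bar>) ` {..<n}))"
proof -
  have "(mat n n (\<lambda>(i, j). if i = j then v i else 0) *\<^sub>v y) $ i = v i * y $ i" if "i < n" for i
  proof -
    have "(mat n n (\<lambda>(i, j). if i = j then v i else 0) *\<^sub>v y) $ i
        = (\<Sum>j<n. (if i = j then v i else 0) * y $ j)"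
      using assms that by (simp add: scalar_prod_def atLeast0LessThan)
    also have "\<dots> = (\<Sum>j<n. if j = i then v i * y $ i else 0)"
      by (intro sum.cong) auto
    finally show ?thesis
      using that by simp
  qed
  thus ?thesis
    unfolding linf_norm_def by (intro arg_cong[where f = Max] arg_cong[where f = "insert 0"]) auto
qed

text \<open>The quantifier over \<open>x\<close> is uncountable, but each \<open>x\<close> contributes a condition on the reciprocals
  of the diagonal that is closed.\<close>

lemma measurable_Max_bound:
  fixes Y :: "nat \<Rightarrow> 'a \<Rightarrow> real" and y :: "'b \<Rightarrow> nat \<Rightarrow> real"
  assumes Y: "\<And>i. i < n \<Longrightarrow> Y i \<in> borel_measurable M"
  shows "{\<omega> \<in> space M. \<forall>x\<in>S. k x \<le> Max (insert 0 ((\<lambda>i. \<bar>Y i \<omega> * y x i\<bar>) ` {..<n}))} \<in> sets M"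
proof -
  \<comment> \<open>Padding with zeros gives a map into the full product space, so that preimages of
    closed sets are measurable.\<close>
  define V where "V \<omega> i = (if i < n then Y i \<omega> else 0)" for \<omega> i
  have V: "V \<in> borel_measurable M"
  proof (rule measurable_coordinatewise_then_product)
    show "(\<lambda>\<omega>. V \<omega> i) \<in> borel_measurable M" for i
      using Y by (cases "i < n") (simp_all add: V_def)
  qed
  define C where "C = (\<Inter>x\<in>S. {v :: nat \<Rightarrow> real. k x \<le> 0} \<union> (\<Union>i<n. {v. k x \<le> \<bar>v i * y x i\<bar>}))"
  have cont: "continuous_on UNIV (\<lambda>v :: nat \<Rightarrow> real. v i)" for i
    by (rule continuous_on_product_coordinates)
  have "closed C"
    unfolding C_def
    by (intro closed_INT ballI closed_Un closed_UN closed_Collect_le continuous_intros cont) auto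
  hence "V -` C \<inter> space M \<in> sets M"
    using V by (intro measurable_sets[OF V] borel_closed) auto
  also have "V -` C \<inter> space M = {\<omega> \<in> space M. \<forall>x\<in>S. k x \<le> Max (insert 0 ((\<lambda>i. \<bar>Y i \<omega> * y x i\<bar>) ` {..<n}))}"
  proof -
    have "k x \<le> Max (insert 0 ((\<lambda>i. \<bar>Y i \<omega> * y x i\<bar>) ` {..<n})) \<longleftrightarrow> k x \<le> 0 \<or> (\<exists>i\<in>{..<n}. k x \<le> \<bar>V \<omega> i * y x i\<bar>)" for x \<omega>
      by (subst Max_ge_iff) (auto simp: V_def)
    hence "V \<omega> \<in> C \<longleftrightarrow> (\<forall>x\<in>S. k x \<le> Max (insert 0 ((\<lambda>i. \<bar>Y i \<omega> * y x i\<bar>) ` {..<n})))" for \<omega>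
      by (simp only: C_def INT_iff Un_iff UN_iff mem_Collect_eq)
    thus ?thesis by blast
  qed
  finally show ?thesis .
qed

section \<open>Reduction to the column space of the matrix\<close>

theorem theorem12:
  shows "\<exists>c>0. \<forall>G. property_P G \<longrightarrow>
    (\<exists>\<alpha>\<ge>1. \<forall>(n::nat) (m::nat) (d::nat) (A :: real mat) (M :: 'a measure) (D :: 'a \<Rightarrow> real mat).
       A \<in> carrier_mat n m \<and> vec_space.rank n A = d \<and> d \<le> n \<and> random_diagonal_mat G n M D \<longrightarrow>
       measure M {\<omega> \<in> space M. \<exists>Dinv. mat_inverse (D \<omega>) = Some Dinv \<and>
         (\<forall>x \<in> carrier_vec m.
            c * (1 / (\<alpha> * real d * ln (real n))) * orlicz_norm G (A *\<^sub>v x)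
              \<le> linf_norm (Dinv *\<^sub>v (A *\<^sub>v x)))} \<ge> 0.98)"
proof (rule exI[of _ "1 / 256"], intro conjI allI impI)
  fix G assume "property_P G"
  then interpret orlicz_function G
    by (rule property_P_orlicz_function)
  show "\<exists>\<alpha>\<ge>1. \<forall>(n::nat) (m::nat) (d::nat) (A :: real mat) (M :: 'a measure) (D :: 'a \<Rightarrow> real mat).
       A \<in> carrier_mat n m \<and> vec_space.rank n A = d \<and> d \<le> n \<and> random_diagonal_mat G n M D \<longrightarrow>
       measure M {\<omega> \<in> space M. \<exists>Dinv. mat_inverse (D \<omega>) = Some Dinv \<and>
         (\<forall>x \<in> carrier_vec m.
            1 / 256 * (1 / (\<alpha> * real d * ln (real n))) * orlicz_norm G (A *\<^sub>v x)
              \<le> linf_norm (Dinv *\<^sub>v (A *\<^sub>v x)))} \<ge> 0.98"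
  \<comment> \<open>All constants obtained are absolute, so \<open>\<alpha> = 1\<close> serves for
    every \<open>G\<close>.\<close>
  proof (rule exI[of _ 1], intro conjI allI impI)
    fix n m d :: nat and A :: "real mat" and M :: "'a measure" and D :: "'a \<Rightarrow> real mat"
    assume *: "A \<in> carrier_mat n m \<and> vec_space.rank n A = d \<and> d \<le> n \<and> random_diagonal_mat G n M D"
    define X where "X i \<omega> = D \<omega> $$ (i, i)" for i \<omega>
    have A: "A \<in> carrier_mat n m" and rank: "vec_space.rank n A = d" and d: "d \<le> n"
      using * by auto
    have D: "prob_space M" "\<And>\<omega>. \<omega> \<in> space M \<Longrightarrow> D \<omega> \<in> carrier_mat n n"
      "\<And>\<omega>. \<omega> \<in> space M \<Longrightarrow> diagonal_mat (D \<omega>)"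
      "prob_space.indep_vars M (\<lambda>_. borel) X {..<n}"
      "\<And>i t. i < n \<Longrightarrow> t \<ge> 0 \<Longrightarrow> cdf (distr M borel (X i)) t = 1 - exp (- G t)"
      using * unfolding random_diagonal_mat_def X_def by auto
    interpret prob_space M by (rule D(1))
    interpret orlicz_variables M G n X
      by unfold_locales (use D in auto)
    define k where "k x = 1 / 256 * (1 / (1 * real d * ln (real n))) * orlicz_norm G (A *\<^sub>v x)" for x
    \<comment> \<open>The event of the claim in terms of the diagonal entries. It must be shown
      measurable before its probability can be compared with that of the event
      \<open>E\<close>.\<close>
    define S where "S = {\<omega> \<in> space M. \<forall>i<n. X i \<omega> \<noteq> 0} \<inter> {\<omega> \<in> space M. \<forall>x\<in>carrier_vec m.
      k x \<le> Max (insert 0 ((\<lambda>i. \<bar>1 / X i \<omega> * (A *\<^sub>v x) $ i\<bar>) ` {..<n}))}"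
    have "(\<exists>Dinv. mat_inverse (D \<omega>) = Some Dinv \<and>
        (\<forall>x \<in> carrier_vec m. k x \<le> linf_norm (Dinv *\<^sub>v (A *\<^sub>v x)))) \<longleftrightarrow>
      (\<forall>i<n. X i \<omega> \<noteq> 0) \<and> (\<forall>x\<in>carrier_vec m.
        k x \<le> Max (insert 0 ((\<lambda>i. \<bar>1 / X i \<omega> * (A *\<^sub>v x) $ i\<bar>) ` {..<n})))"
      if "\<omega> \<in> space M" for \<omega>
      unfolding mat_inverse_diagonal[OF D(2)[OF that] D(3)[OF that]] X_def
      using linf_norm_diagonal[OF mult_mat_vec_carrier[OF A]]
      by (intro conj_cong refl ball_cong) simp
    hence eq: "{\<omega> \<in> space M. \<exists>Dinv. mat_inverse (D \<omega>) = Some Dinv \<and>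
         (\<forall>x \<in> carrier_vec m. k x \<le> linf_norm (Dinv *\<^sub>v (A *\<^sub>v x)))} = S"
      by (auto simp: S_def)
    have S: "S \<in> events"
      unfolding S_def
    proof (intro sets.Int measurable_Max_bound)
      show "{\<omega> \<in> space M. \<forall>i<n. X i \<omega> \<noteq> 0} \<in> events"
        using measurable_X by measurable
      show "(\<lambda>\<omega>. 1 / X i \<omega>) \<in> borel_measurable M" if "i < n" for i
        using measurable_X[OF that] by measurable
    qed
    have prob_S: "prob S \<ge> 98 / 100"
    proof (cases "2 \<le> n \<and> 0 < d")
      \<comment> \<open>If \<open>d = 0\<close> or \<open>n = 1\<close>, the denominator is 0 and
        division by zero yields 0, so the left side vanishes; \<open>n = 0\<close> forces
        \<open>d = 0\<close>. What remains is invertibility, which holds almost surely.\<close>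
      case False
      hence k0: "k x = 0" for x
        using d by (cases "n = 1") (auto simp: k_def)
      have "0 \<le> Max (insert 0 (f ` {..<n}))" for f :: "nat \<Rightarrow> real"
        by (intro Max_ge) auto
      hence sub: "{\<omega> \<in> space M. \<forall>i<n. X i \<omega> \<noteq> 0} \<subseteq> S"
        unfolding S_def k0 by blast
      have "AE \<omega> in M. \<omega> \<in> S"
        using AE_pos AE_space
      proof eventually_elim
        case (elim \<omega>)
        hence "\<omega> \<in> {\<omega> \<in> space M. \<forall>i<n. X i \<omega> \<noteq> 0}"
          by force
        with sub show ?case by blast
      qed
      hence "prob S = 1"
        using S by (simp add: prob_eq_1)
      thus ?thesis by simp
    next
      case True
      obtain B where
        B: "\<forall>k<d. \<forall>l<d. (\<Sum>i<n. B k i * B l i) = (if k = l then 1 else 0)"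
        and span: "\<forall>x\<in>carrier_vec m. \<exists>z. \<forall>i<n. (A *\<^sub>v x) $ i = (\<Sum>k<d. z k * B k i)"
        using column_space_orthonormal_expansion[OF A] unfolding rank by (elim exE conjE)
      obtain E where E: "E \<in> events" "prob E \<ge> 98 / 100"
        and good: "\<forall>\<omega>\<in>E. (\<forall>i<n. X i \<omega> > 0) \<and>
          (\<forall>y z. (\<forall>i<n. y i = (\<Sum>k<d. z k * B k i)) \<longrightarrow>
            (\<exists>i<n. orlicz_fun G n y / (256 * real d * ln (real n)) \<le> \<bar>y i\<bar> / X i \<omega>))"
        using subspace_domination[of d B] B True d by (elim bexE conjE) auto
      have "E \<subseteq> S"
      proof
        fix \<omega> assume \<omega>: "\<omega> \<in> E"
        have sp: "\<omega> \<in> space M"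
          using sets.sets_into_space[OF E(1)] \<omega> by auto
        have pos: "\<forall>i<n. X i \<omega> > 0"
          using good \<omega> by blast
        hence nz: "\<forall>i<n. X i \<omega> \<noteq> 0"
          by force
        have "k x \<le> Max (insert 0 ((\<lambda>i. \<bar>1 / X i \<omega> * (A *\<^sub>v x) $ i\<bar>) ` {..<n}))"
          if x: "x \<in> carrier_vec m" for x
        proof -
          obtain z where "\<forall>i<n. (A *\<^sub>v x) $ i = (\<Sum>k<d. z k * B k i)"
            using span x by blast
          with good \<omega> obtain i where i: "i < n"
            "orlicz_fun G n (\<lambda>i. (A *\<^sub>v x) $ i) / (256 * real d * ln (real n)) \<le> \<bar>(A *\<^sub>v x) $ i\<bar> / X i \<omega>"
            by blast
          have "k x \<le> \<bar>(A *\<^sub>v x) $ i\<bar> / X i \<omega>"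
            using i(2) A by (simp add: k_def orlicz_norm_eq_orlicz_fun)
          also have "\<dots> = \<bar>1 / X i \<omega> * (A *\<^sub>v x) $ i\<bar>"
            using pos i(1) by (simp add: abs_mult abs_of_pos)
          also have "\<dots> \<le> Max (insert 0 ((\<lambda>i. \<bar>1 / X i \<omega> * (A *\<^sub>v x) $ i\<bar>) ` {..<n}))"
            using i(1) by (intro Max_ge) auto
          finally show ?thesis .
        qed
        thus "\<omega> \<in> S"
          using sp nz by (simp add: S_def)
      qed
      thus ?thesis
        using E(2) finite_measure_mono[OF \<open>E \<subseteq> S\<close> S] by linarith
    qed
    show "measure M {\<omega> \<in> space M. \<exists>Dinv. mat_inverse (D \<omega>) = Some Dinv \<and>
         (\<forall>x \<in> carrier_vec m.
            1 / 256 * (1 / (1 * real d * ln (real n))) * orlicz_norm G (A *\<^sub>v x)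
              \<le> linf_norm (Dinv *\<^sub>v (A *\<^sub>v x)))} \<ge> 0.98"
      unfolding eq[unfolded k_def] using prob_S by simp
  qed simp
qed simp

end
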